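(* Let $\mathfrak g$ be an affine Kac--Moody algebra of type $B_n^{(1)}$, $C_n^{(1)}$, $A_{2n-1}^{(2)}$, $D_{n+1}^{(2)}$, $E_6^{(1)}$ or $E_7^{(1)}$, and let $\ell\ge 0$ be an integer. Let $\mathsf N$ be $3$ for $E_6^{(1)}$ and $2$ for the other types, let $\upsilon\in\mathfrak S_{\{0,\dots,n\}}$ be the permutation of order $\mathsf N$ and $(s_0,s_1,\dots,s_n)$ the vector attached to $\mathfrak g$ in the context. Let the cyclic group $C_{\mathsf N}=\langle\sigma_{\mathsf N}\rangle$ of order $\mathsf N$ act on the set $P^+_{\mathrm{cl},\ell}$ of classical dominant integral weights of level $\ell$ by $$\sigma_{\mathsf N}\cdot\sum_{i=0}^n m_i\Lambda_i=\sum_{i=0}^n m_{\upsilon(i)}\Lambda_i ,$$ and let $$P^+_{\mathrm{cl},\ell}(q)=\sum_{\sum_i m_i\Lambda_i\in P^+_{\mathrm{cl},\ell}} q^{\,\sum_{i=0}^n s_i m_i}.$$ Then the triple $\bigl(P^+_{\mathrm{cl},\ell},\,C_{\mathsf N},\,P^+_{\mathrm{cl},\ell}(q)\bigr)$ exhibits the cyclic sieving phenomenon.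
   Context: Write the canonical central element of $\mathfrak g$ as $c=\sum_{i=0}^n a_i^\vee h_i$. Classical dominant integral weights of level $\ell$ (dominant integral weights of level $\ell$ modulo $\mathbb Z\delta$) are identified with $P^+_{\mathrm{cl},\ell}=\{\sum_{i=0}^n m_i\Lambda_i: m_i\in\mathbb Z_{\ge0},\ \sum_{i=0}^n a_i^\vee m_i=\ell\}$. Data for each type, in the form $(a_0^\vee,\dots,a_n^\vee)$; $(s_0,\dots,s_n)$; $\upsilon$: - $B_n^{(1)}$ ($n\ge3$): $(1,1,2,\dots,2,1)$ (with $n-2$ twos); $(0,\dots,0,1)$; $\upsilon=(0,n)$. - $D_{n+1}^{(2)}$ ($n\ge2$): $(1,2,\dots,2,1)$ (with $n-1$ twos); $(0,\dots,0,1)$; $\upsilon=(0,n)$. - $C_n^{(1)}$ ($n\ge2$): $(1,1,\dots,1)$; $s_j=1$ for $j$ odd and $s_j=0$ for $j$ even; $\upsilon=(0,1)(2,3)\cdots(n-1,n)$ if $n$ is odd and $\upsilon=(0,1)(2,3)\cdots(n-2,n-1)$ if $n$ is even. - $A_{2n-1}^{(2)}$ ($n\ge3$): $(1,1,2,\dots,2)$ (with $n-1$ twos); same $s_j$ and same $\upsilon$ as for $C_n^{(1)}$. - $E_6^{(1)}$ ($n=6$): $(1,1,2,2,3,2,1)$; $(0,1,0,2,0,1,2)$; $\upsilon=(0,1,6)(2,3,5)$. - $E_7^{(1)}$ ($n=7$): $(1,2,2,3,4,3,2,1)$; $(0,0,1,0,0,1,0,1)$; $\upsilon=(0,7)(1,6)(3,5)$.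 Cyclic sieving phenomenon: for a finite set $X$ with an action of a finite cyclic group $C$, and a polynomial $X(q)$ with nonnegative integer coefficients, the triple $(X,C,X(q))$ exhibits the cyclic sieving phenomenon if for every $g\in C$ one has $|X^g|=X(\omega_{o(g)})$, where $o(g)$ is the order of $g$, $\omega_d$ is a primitive $d$-th root of unity, and $X^g$ is the set of points fixed by $g$. *)

theory Defs
  imports
    Complex_Main
    "HOL-Algebra.Elementary_Groups"
    "HOL-Algebra.Multiplicative_Group"
    "HOL-Algebra.Group_Action"
    "HOL-Combinatorics.Cycles"
    "HOL-Computational_Algebra.Polynomial"
begin

section \<open>The cyclic sieving phenomenon\<close>

definition primitive_root_of_unity :: "nat \<Rightarrow> complex \<Rightarrow> bool" where
  "primitive_root_of_unity d w \<longleftrightarrow>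
     d > 0 \<and> w ^ d = 1 \<and> (\<forall>k. 0 < k \<and> k < d \<longrightarrow> w ^ k \<noteq> 1)"

text \<open>
  Nonnegativity of the coefficients of the polynomial is built into the type
  \<^typ>\<open>nat poly\<close>. The identity is demanded for every choice of the primitive root.
\<close>

definition cyclic_sieving ::
  "'x set \<Rightarrow> ('g, 'b) monoid_scheme \<Rightarrow> ('g \<Rightarrow> 'x \<Rightarrow> 'x) \<Rightarrow> nat poly \<Rightarrow> bool" where
  "cyclic_sieving X C \<phi> P \<longleftrightarrow>
     finite X \<and> group C \<and> cyclic_group C \<and> finite (carrier C) \<and> group_action C X \<phi> \<and>
     (\<forall>g \<in> carrier C. \<forall>w. primitive_root_of_unity (group.ord C g) w \<longrightarrow>
        of_nat (card {x \<in> X. \<phi> g x = x}) = poly (map_poly of_nat P) w)"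

section \<open>Combinatorial data of the affine types\<close>

text \<open>
  The argument is the rank parameter \<open>n\<close>, so the Dynkin diagram has vertices \<open>0, \<dots>, n\<close>:
  \<open>B1 n\<close>, \<open>C1 n\<close>, \<open>A2 n\<close>, \<open>D2 n\<close> stand for the types
  $B_n^{(1)}$, $C_n^{(1)}$, $A_{2n-1}^{(2)}$, $D_{n+1}^{(2)}$, and \<open>E6\<close>, \<open>E7\<close> for
  $E_6^{(1)}$, $E_7^{(1)}$.
\<close>

datatype affine_type = B1 nat | C1 nat | A2 nat | D2 nat | E6 | E7

fun valid_type :: "affine_type \<Rightarrow> bool" where
  "valid_type (B1 n) \<longleftrightarrow> n \<ge> 3"
| "valid_type (C1 n) \<longleftrightarrow> n \<ge> 2"
| "valid_type (A2 n) \<longleftrightarrow> n \<ge> 3"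
| "valid_type (D2 n) \<longleftrightarrow> n \<ge> 2"
| "valid_type E6 \<longleftrightarrow> True"
| "valid_type E7 \<longleftrightarrow> True"

fun rk :: "affine_type \<Rightarrow> nat" where
  "rk (B1 n) = n"
| "rk (C1 n) = n"
| "rk (A2 n) = n"
| "rk (D2 n) = n"
| "rk E6 = 6"
| "rk E7 = 7"

text \<open>
  The coefficients $(a_0^\vee, \dots, a_n^\vee)$ of the canonical central element
  $c = \sum_i a_i^\vee h_i$.
\<close>

fun comarks :: "affine_type \<Rightarrow> nat list" where
  "comarks (B1 n) = [1, 1] @ replicate (n - 2) 2 @ [1]"
| "comarks (C1 n) = replicate (n + 1) 1"
| "comarks (A2 n) = [1, 1] @ replicate (n - 1) 2"
| "comarks (D2 n) = [1] @ replicate (n - 1) 2 @ [1]"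
| "comarks E6 = [1, 1, 2, 2, 3, 2, 1]"
| "comarks E7 = [1, 2, 2, 3, 4, 3, 2, 1]"

fun sieving_vector :: "affine_type \<Rightarrow> nat list" where
  "sieving_vector (B1 n) = replicate n 0 @ [1]"
| "sieving_vector (C1 n) = map (\<lambda>j. if odd j then 1 else 0) [0..<n + 1]"
| "sieving_vector (A2 n) = map (\<lambda>j. if odd j then 1 else 0) [0..<n + 1]"
| "sieving_vector (D2 n) = replicate n 0 @ [1]"
| "sieving_vector E6 = [0, 1, 0, 2, 0, 1, 2]"
| "sieving_vector E7 = [0, 0, 1, 0, 0, 1, 0, 1]"

fun N_of :: "affine_type \<Rightarrow> nat" where
  "N_of E6 = 3"
| "N_of _ = 2"

text \<open>
  The product $(0,1)(2,3)\cdots$ of all transpositions $(2k, 2k+1)$ with $2k + 1 \le n$; its last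
  factor is $(n-1,n)$ for odd $n$ and $(n-2,n-1)$ for even $n$.
\<close>

definition adjacent_pairs :: "nat \<Rightarrow> nat \<Rightarrow> nat" where
  "adjacent_pairs n =
     foldr (\<circ>) (map (\<lambda>k. transpose (2 * k) (2 * k + 1)) [0..<(n + 1) div 2]) id"

fun upsilon :: "affine_type \<Rightarrow> nat \<Rightarrow> nat" where
  "upsilon (B1 n) = transpose 0 n"
| "upsilon (C1 n) = adjacent_pairs n"
| "upsilon (A2 n) = adjacent_pairs n"
| "upsilon (D2 n) = transpose 0 n"
| "upsilon E6 = cycle_of_list [0, 1, 6] \<circ> cycle_of_list [2, 3, 5]"
| "upsilon E7 = transpose 0 7 \<circ> transpose 1 6 \<circ> transpose 3 5"

section \<open>Classical dominant integral weights\<close>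

text \<open>
  The classical weight $\sum_{i=0}^n m_i \Lambda_i$ is represented by its coefficient function
  \<open>m\<close>, extended by \<open>0\<close> to indices beyond \<open>n\<close> so that the representation is unique.
\<close>

definition dominant_weights :: "affine_type \<Rightarrow> nat \<Rightarrow> (nat \<Rightarrow> nat) set" where
  "dominant_weights T l =
     {m. (\<forall>i > rk T. m i = 0) \<and> (\<Sum>i\<le>rk T. comarks T ! i * m i) = l}"

definition sigma :: "affine_type \<Rightarrow> (nat \<Rightarrow> nat) \<Rightarrow> (nat \<Rightarrow> nat)" where
  "sigma T m = (\<lambda>i. m (upsilon T i))"

text \<open>
  The cyclic group of order \<open>N\<close> is the additive group of integers modulo \<open>N\<close>, whose generator
  \<open>1\<close> acts as \<^const>\<open>sigma\<close>. The restriction to the set of weights is required by the library's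
  notion of a group action, which maps into extensional bijections.
\<close>

definition sigma_action :: "affine_type \<Rightarrow> nat \<Rightarrow> int \<Rightarrow> (nat \<Rightarrow> nat) \<Rightarrow> (nat \<Rightarrow> nat)" where
  "sigma_action T l k = restrict (sigma T ^^ nat k) (dominant_weights T l)"

definition weight_poly :: "affine_type \<Rightarrow> nat \<Rightarrow> nat poly" where
  "weight_poly T l =
     (\<Sum>m \<in> dominant_weights T l.
        Polynomial.monom 1 (\<Sum>i\<le>rk T. sieving_vector T ! i * m i))"

end

theory Submission
  imports Defs "HOL-Computational_Algebra.Formal_Power_Series" "HOL-Number_Theory.Cong"
begin

text \<open>
  Summing over all levels, the weight polynomials at a root of unity \<open>w\<close> have the generating function
  $\prod_{i=0}^n (1 - w^{s_i} t^{a_i^\vee})^{-1}$. A weight fixed by the generator is constant on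
  the orbits of $\upsilon$, so the fixed points are counted by
  $\prod_O (1 - t^{b_O})^{-1}$, where $b_O$ is the sum of the $a_i^\vee$ over the orbit $O$.
  For \<open>w\<close> primitive of order $\mathsf N$ the two products agree. As $\mathsf N$ is prime, this and the case
  $w = 1$ cover all group elements.
\<close>

section \<open>Cyclic actions of prime order\<close>

lemma cyclic_integer_mod_group: "cyclic_group (integer_mod_group N)"
proof (cases "N \<le> 1")
  case True
  \<comment> \<open>\<open>N = 0\<close> gives the group of all integers and \<open>N = 1\<close>
    the trivial group; both fall outside the residue description of the carrier used below.\<close>
  then consider "N = 0" | "N = 1" by linarith
  then show ?thesis
    by cases (auto simp: integer_mod_group_def[of 0] trivial_integer_mod_group
      intro: trivial_imp_cyclic_group)
next
  case False
  have "carrier (integer_mod_group N) = range (\<lambda>n::int. n mod int N)"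
  proof
    show "carrier (integer_mod_group N) \<subseteq> range (\<lambda>n::int. n mod int N)"
    proof
      fix x assume "x \<in> carrier (integer_mod_group N)"
      with False have "x = x mod int N"
        by (auto simp: carrier_integer_mod_group)
      then show "x \<in> range (\<lambda>n::int. n mod int N)"
        by (rule range_eqI)
    qed
  qed (use False in \<open>auto simp: carrier_integer_mod_group\<close>)
  then have "carrier (integer_mod_group N) = range (\<lambda>n::int. 1 [^]\<^bsub>integer_mod_group N\<^esub> n)"
    by (simp add: int_pow_integer_mod_group)
  with False show ?thesis
    unfolding group.cyclic_group[OF group_integer_mod_group]
    by (intro bexI[of _ 1]) auto
qed

lemma funpow_mod_eq_on:
  assumes "f \<in> X \<rightarrow> X" "\<And>x. x \<in> X \<Longrightarrow> (f ^^ N) x = x" "x \<in> X"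
  shows "(f ^^ (k mod N)) x = (f ^^ k) x"
proof -
  have "(f ^^ (N * j)) x = x" for j
    by (induction j) (use assms in \<open>auto simp: funpow_add add.commute[of N]\<close>)
  moreover have "(f ^^ k) x = (f ^^ (k mod N + N * (k div N))) x"
    by simp
  ultimately show ?thesis
    by (simp only: funpow_add o_apply)
qed

text \<open>Representatives in the carrier run from \<open>0\<close> to \<open>N - 1\<close>, so
  \<open>nat\<close> loses nothing; addition wraps around modulo \<open>N\<close>, and
  \<open>id\<close> absorbs the wrap.\<close>

lemma funpow_restrict_action:
  assumes "N > 0" and f: "f \<in> X \<rightarrow> X" and id: "\<And>x. x \<in> X \<Longrightarrow> (f ^^ N) x = x"
  shows "group_action (integer_mod_group N) X (\<lambda>k. restrict (f ^^ nat k) X)"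
proof -
  have closed: "(f ^^ k) x \<in> X" if "x \<in> X" for k x
    using that f by (induction k) auto
  have add: "(f ^^ i) ((f ^^ j) x) = (f ^^ ((i + j) mod N)) x" if "x \<in> X" for i j x
    using funpow_mod_eq_on[OF f id that] by (simp add: funpow_add)
  have bij: "restrict (f ^^ i) X \<in> Bij X" if "i < N" for i
  proof -
    \<comment> \<open>Since the \<open>N\<close>-th power is the identity on \<open>X\<close>, the
      power \<open>N - i\<close> inverts the power \<open>i\<close>.\<close>
    have "bij_betw (f ^^ i) X X"
      by (rule bij_betw_byWitness[where f' = "f ^^ (N - i)"]) (use that closed add in auto)
    then show ?thesis
      by (simp add: Bij_def bij_betw_def inj_on_def)
  qed
  have "(\<lambda>k. restrict (f ^^ nat k) X) \<in> hom (integer_mod_group N) (BijGroup X)"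
  proof (rule homI)
    fix x y assume "x \<in> carrier (integer_mod_group N)" "y \<in> carrier (integer_mod_group N)"
    then have xy: "0 \<le> x" "x < int N" "0 \<le> y" "y < int N"
      using \<open>N > 0\<close> by (auto simp: carrier_integer_mod_group)
    then have "nat ((x + y) mod int N) = (nat x + nat y) mod N"
      by (simp add: nat_mod_distrib nat_add_distrib)
    moreover have "nat x < N" "nat y < N"
      using xy by linarith+
    ultimately show "restrict (f ^^ nat (x \<otimes>\<^bsub>integer_mod_group N\<^esub> y)) X =
        restrict (f ^^ nat x) X \<otimes>\<^bsub>BijGroup X\<^esub> restrict (f ^^ nat y) X"
      using bij closed by (auto simp: BijGroup_def compose_def add restrict_def)
  qed (use bij \<open>N > 0\<close> in \<open>auto simp: BijGroup_def carrier_integer_mod_group nat_less_iff\<close>)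
  then show ?thesis
    by (simp add: group_action_def group_hom_def group_hom_axioms_def group_BijGroup)
qed

lemma ord_integer_mod_group_prime:
  assumes "prime N" "g \<in> carrier (integer_mod_group N)" "g \<noteq> 0"
  shows "group.ord (integer_mod_group N) g = N"
proof -
  interpret group "integer_mod_group N" by simp
  from assms have g: "0 < g" "g < int N"
    by (auto simp: carrier_integer_mod_group split: if_splits)
  have "int n * g mod int N = 0 \<longleftrightarrow> N dvd n" for n
  proof -
    have "\<not> int N dvd g"
      using g zdvd_not_zless by blast
    then have "int N dvd int n * g \<longleftrightarrow> int N dvd int n"
      using assms(1) by (auto simp: prime_dvd_mult_iff)
    then show ?thesis
      by (simp add: mod_eq_0_iff_dvd)
  qed
  then show ?thesis
    using assms(2) by (intro ord_unique[THEN iffD2]) auto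
qed

text \<open>Every nonzero residue modulo a prime generates the group, so it has order
  \<open>N\<close> and the same fixed points as \<open>f\<close>. The identity has order 1, whose
  only primitive root is 1. Two evaluations of the polynomial therefore suffice.\<close>

lemma cyclic_sieving_prime_order:
  assumes "prime N" and "finite X" and f: "f \<in> X \<rightarrow> X"
    and id: "\<And>x. x \<in> X \<Longrightarrow> (f ^^ N) x = x"
    and one: "poly (map_poly of_nat P) (1::complex) = of_nat (card X)"
    and root: "\<And>w. primitive_root_of_unity N w \<Longrightarrow>
      poly (map_poly of_nat P) w = of_nat (card {x \<in> X. f x = x})"
  shows "cyclic_sieving X (integer_mod_group N) (\<lambda>k. restrict (f ^^ nat k) X) P"
proof -
  let ?G = "integer_mod_group N"
  have "N > 0"
    using \<open>prime N\<close> by (simp add: prime_gt_0_nat)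
  have "of_nat (card {x \<in> X. restrict (f ^^ nat g) X x = x}) = poly (map_poly of_nat P) w"
    if g: "g \<in> carrier ?G" and w: "primitive_root_of_unity (group.ord ?G g) w" for g w
  proof (cases "g = 0")
    case True
    then have "group.ord ?G g = 1"
      using group.ord_id[OF group_integer_mod_group, of N] by simp
    with w have "w = 1"
      by (simp add: primitive_root_of_unity_def)
    moreover have "{x \<in> X. restrict (f ^^ nat g) X x = x} = X"
      using True by auto
    ultimately show ?thesis
      using one by simp
  next
    case False
    have "nat g < N" "nat g > 0"
      using g False \<open>N > 0\<close> by (auto simp: carrier_integer_mod_group)
    then have "coprime (nat g) N"
      using \<open>prime N\<close> by (metis coprime_commute nat_dvd_not_less prime_imp_coprime)
    then obtain j where j: "[nat g * j = 1] (mod N)"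
      using cong_solve_coprime_nat by (metis One_nat_def)
    \<comment> \<open>\<open>f\<close> is itself a power of \<open>f ^^ nat g\<close>, so both have the same fixed points.\<close>
    have "f x = x" if "x \<in> X" "(f ^^ nat g) x = x" for x
    proof -
      have "((f ^^ nat g) ^^ j) x = x"
        using that(2) by (induction j) auto
      then have "(f ^^ (nat g * j mod N)) x = x"
        using funpow_mod_eq_on[OF f id that(1)] by (simp add: funpow_mult)
      moreover have "nat g * j mod N = 1"
        using j prime_gt_1_nat[OF \<open>prime N\<close>] by (simp add: cong_def)
      ultimately show ?thesis
        by simp
    qed
    moreover have "(f ^^ k) x = x" if "f x = x" for x k
      using that by (induction k) auto
    ultimately have "{x \<in> X. restrict (f ^^ nat g) X x = x} = {x \<in> X. f x = x}"
      by auto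
    moreover have "group.ord ?G g = N"
      using ord_integer_mod_group_prime[OF \<open>prime N\<close> g False] .
    ultimately show ?thesis
      using root w by simp
  qed
  then show ?thesis
    using assms \<open>N > 0\<close> funpow_restrict_action[OF \<open>N > 0\<close> f id]
    by (simp add: cyclic_sieving_def cyclic_integer_mod_group carrier_integer_mod_group)
qed

section \<open>Generating functions of weighted linear equations\<close>

text \<open>Generalises the weights of level \<open>l\<close> to an arbitrary index set, which
  allows both induction on \<open>I\<close> and passage to orbit representatives.\<close>

definition weighted_solutions :: "('i \<Rightarrow> nat) \<Rightarrow> 'i set \<Rightarrow> nat \<Rightarrow> ('i \<Rightarrow> nat) set" where
  "weighted_solutions a I l = {m. (\<forall>i. i \<notin> I \<longrightarrow> m i = 0) \<and> (\<Sum>i\<in>I. a i * m i) = l}"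

lemma finite_weighted_solutions:
  assumes "finite I" "\<And>i. i \<in> I \<Longrightarrow> a i > 0"
  shows "finite (weighted_solutions a I l)"
proof (rule finite_subset)
  show "weighted_solutions a I l \<subseteq> {m. \<forall>i. (i \<in> I \<longrightarrow> m i \<in> {..l}) \<and> (i \<notin> I \<longrightarrow> m i = 0)}"
  proof (clarsimp simp: weighted_solutions_def)
    fix m i assume "i \<in> I"
    then have "a i * m i \<le> (\<Sum>i\<in>I. a i * m i)"
      using assms(1) by (intro member_le_sum) auto
    moreover have "m i \<le> a i * m i"
      using assms(2)[OF \<open>i \<in> I\<close>] by simp
    ultimately show "m i \<le> (\<Sum>i\<in>I. a i * m i)"
      by linarith
  qed
  show "finite {m. \<forall>i. (i \<in> I \<longrightarrow> m i \<in> {..l}) \<and> (i \<notin> I \<longrightarrow> m i = (0::nat))}"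
    using finite_set_of_finite_funs[OF assms(1), of "{..l}" 0] by simp
qed

text \<open>For finite \<open>I\<close> and positive \<open>a\<close>, this is the coefficient of
  \<open>X ^ l\<close> in the product over \<open>I\<close> of
  \<open>1 / (1 - z i * X ^ a i)\<close>.\<close>

definition solution_sum ::
  "('i \<Rightarrow> 'a::comm_ring_1) \<Rightarrow> ('i \<Rightarrow> nat) \<Rightarrow> 'i set \<Rightarrow> nat \<Rightarrow> 'a" where
  "solution_sum z a I l = (\<Sum>m\<in>weighted_solutions a I l. \<Prod>i\<in>I. z i ^ m i)"

text \<open>Solutions with \<open>m j = 0\<close> live on \<open>I\<close>. In the others, lowering
  \<open>m j\<close> by one lowers the level by \<open>a j\<close> and splits off one factor
  \<open>z j\<close>. This is the coefficient form of multiplication by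
  \<open>1 - z j * X ^ a j\<close>.\<close>

lemma solution_sum_insert:
  assumes "finite I" "j \<notin> I" "\<And>i. i \<in> insert j I \<Longrightarrow> a i > 0"
  shows "solution_sum z a (insert j I) l =
    solution_sum z a I l + (if l < a j then 0 else z j * solution_sum z a (insert j I) (l - a j))"
proof -
  let ?S = "weighted_solutions a (insert j I)"
  let ?W = "\<lambda>m. \<Prod>i\<in>insert j I. z i ^ m i"
  have fin: "finite (?S l)" for l
    using assms by (intro finite_weighted_solutions) auto
  have zero: "{m \<in> ?S l. m j = 0} = weighted_solutions a I l"
  proof -
    have "m i = 0" if "m j = 0" "\<forall>i. i \<notin> insert j I \<longrightarrow> m i = 0" "i \<notin> I" for m :: "_ \<Rightarrow> nat" and i
      using that by (cases "i = j") auto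
    then show ?thesis
      using assms(1,2) by (auto simp: weighted_solutions_def)
  qed
  have pos: "(\<Sum>m\<in>{m \<in> ?S l. m j \<noteq> 0}. ?W m) =
      (if l < a j then 0 else z j * solution_sum z a (insert j I) (l - a j))"
  proof (cases "l < a j")
    case True
    have "m j = 0" if "m \<in> ?S l" for m
    proof (rule ccontr)
      assume "m j \<noteq> 0"
      then have "a j \<le> a j * m j"
        by simp
      also have "\<dots> \<le> l"
        using that assms(1,2) by (auto simp: weighted_solutions_def)
      finally show False
        using True by simp
    qed
    then have "{m \<in> ?S l. m j \<noteq> 0} = {}"
      by auto
    with True show ?thesis
      by (simp only: sum.empty if_True)
  next
    case False
    have upd: "(\<Sum>i\<in>I. a i * (m(j := k)) i) = (\<Sum>i\<in>I. a i * m i)"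
      "(\<Prod>i\<in>I. z i ^ (m(j := k)) i) = (\<Prod>i\<in>I. z i ^ m i)" for m k
      using assms(2) by (auto intro!: sum.cong prod.cong)
    have "(\<Sum>m\<in>{m \<in> ?S l. m j \<noteq> 0}. ?W m) = (\<Sum>m\<in>?S (l - a j). z j * ?W m)"
    proof (rule sum.reindex_bij_witness[where
          i = "\<lambda>m. m(j := Suc (m j))" and j = "\<lambda>m. m(j := m j - 1)"])
      fix m assume "m \<in> {m \<in> ?S l. m j \<noteq> 0}"
      then obtain k where "m j = Suc k" and "m \<in> ?S l"
        by (auto simp: gr0_conv_Suc)
      then show "m(j := m j - 1) \<in> ?S (l - a j)" "z j * ?W (m(j := m j - 1)) = ?W m"
        "(m(j := m j - 1))(j := Suc ((m(j := m j - 1)) j)) = m"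
        using assms(1,2) upd by (auto simp: weighted_solutions_def mult.assoc)
    qed (use assms(1,2) False upd in \<open>auto simp: weighted_solutions_def\<close>)
    with False show ?thesis
      by (simp add: solution_sum_def sum_distrib_left)
  qed
  have "solution_sum z a (insert j I) l =
      (\<Sum>m\<in>{m \<in> ?S l. m j = 0}. ?W m) + (\<Sum>m\<in>{m \<in> ?S l. m j \<noteq> 0}. ?W m)"
    unfolding solution_sum_def by (rule sum.Int_Diff[OF fin, where B = "{m. m j = 0}", THEN trans])
      (auto intro!: arg_cong2[where f = "(+)"] sum.cong)
  also have "(\<Sum>m\<in>{m \<in> ?S l. m j = 0}. ?W m) = solution_sum z a I l"
    using assms(1,2) by (auto simp: solution_sum_def zero[symmetric] intro!: sum.cong)
  finally show ?thesis
    unfolding pos .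
qed

text \<open>Each inserted index contributes one factor, by the recursion above. A product equal to 1
  replaces an inverse, so no division is required in the coefficient ring.\<close>

lemma solution_sum_fps:
  assumes "finite I" "\<And>i. i \<in> I \<Longrightarrow> a i > 0"
  shows "(\<Prod>i\<in>I. 1 - fps_const (z i) * fps_X ^ a i) * Abs_fps (solution_sum z a I) = 1"
  using assms
proof (induction I rule: finite_induct)
  case empty
  have "weighted_solutions a {} l = (if l = 0 then {\<lambda>_. 0} else {})" for l
    by (auto simp: weighted_solutions_def)
  then show ?case
    by (auto simp: fps_eq_iff solution_sum_def)
next
  case (insert j I)
  have "(1 - fps_const (z j) * fps_X ^ a j) * Abs_fps (solution_sum z a (insert j I)) =
      Abs_fps (solution_sum z a I)"
  proof (rule fps_ext)
    fix l
    show "fps_nth ((1 - fps_const (z j) * fps_X ^ a j) * Abs_fps (solution_sum z a (insert j I))) l =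
        fps_nth (Abs_fps (solution_sum z a I)) l"
      using solution_sum_insert[of I j a z l] insert
      by (simp add: algebra_simps fps_X_power_mult_nth)
  qed
  moreover have "(\<Prod>i\<in>insert j I. 1 - fps_const (z i) * fps_X ^ a i) *
      Abs_fps (solution_sum z a (insert j I)) =
      (\<Prod>i\<in>I. 1 - fps_const (z i) * fps_X ^ a i) *
      ((1 - fps_const (z j) * fps_X ^ a j) * Abs_fps (solution_sum z a (insert j I)))"
    unfolding prod.insert[OF insert.hyps] by (simp only: ac_simps)
  ultimately show ?case
    using insert by simp
qed

section \<open>Counting solutions that are constant on orbits\<close>

text \<open>The map \<open>\<rho>\<close> retracts \<open>I\<close> onto representatives. A solution
  constant on its fibres is determined by its values there, and each representative inherits the
  total coefficient of its fibre.\<close>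

lemma card_folded_solutions:
  assumes "finite I" "\<rho> ` I \<subseteq> I" "\<And>i. i \<in> I \<Longrightarrow> \<rho> (\<rho> i) = \<rho> i"
  shows "card {m \<in> weighted_solutions a I l. \<forall>i\<in>I. m (\<rho> i) = m i} =
    card (weighted_solutions (\<lambda>r. \<Sum>i\<in>{i\<in>I. \<rho> i = r}. a i) (\<rho> ` I) l)"
proof -
  have fold: "(\<Sum>r\<in>\<rho> ` I. (\<Sum>i\<in>{i\<in>I. \<rho> i = r}. a i) * m r) = (\<Sum>i\<in>I. a i * m (\<rho> i))"
    for m :: "_ \<Rightarrow> nat"
  proof -
    have "(\<Sum>r\<in>\<rho> ` I. (\<Sum>i\<in>{i\<in>I. \<rho> i = r}. a i) * m r) =
        (\<Sum>r\<in>\<rho> ` I. \<Sum>i\<in>{i\<in>I. \<rho> i = r}. a i * m (\<rho> i))"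
      by (simp add: sum_distrib_right)
    also have "\<dots> = (\<Sum>i\<in>I. a i * m (\<rho> i))"
      using assms(1) by (intro sum.group) auto
    finally show ?thesis .
  qed
  \<comment> \<open>\<open>?f\<close> restricts to the representatives and \<open>?g\<close> spreads
    values back along the fibres; the default 0 matches the vanishing required outside the index
    set.\<close>
  let ?f = "\<lambda>m i. if i \<in> \<rho> ` I then m i else (0::nat)"
  let ?g = "\<lambda>m i. if i \<in> I then m (\<rho> i) else (0::nat)"
  let ?A = "{m \<in> weighted_solutions a I l. \<forall>i\<in>I. m (\<rho> i) = m i}"
  let ?B = "weighted_solutions (\<lambda>r. \<Sum>i\<in>{i\<in>I. \<rho> i = r}. a i) (\<rho> ` I) l"
  have "bij_betw ?f ?A ?B"
  proof (rule bij_betw_byWitness[where f' = ?g])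
    show "\<forall>m\<in>?A. ?g (?f m) = m"
      by (auto simp: weighted_solutions_def fun_eq_iff)
    show "\<forall>m\<in>?B. ?f (?g m) = m"
      using assms(2,3) by (auto simp: weighted_solutions_def fun_eq_iff)
    show "?f ` ?A \<subseteq> ?B"
      by (auto simp: weighted_solutions_def fold)
    show "?g ` ?B \<subseteq> ?A"
      using assms(2,3) by (auto simp: weighted_solutions_def fold)
  qed
  then show ?thesis
    by (rule bij_betw_same_card)
qed

lemma solution_sum_eq_card_folded:
  assumes "finite I" "\<And>i. i \<in> I \<Longrightarrow> a i > 0"
    and "\<rho> ` I \<subseteq> I" "\<And>i. i \<in> I \<Longrightarrow> \<rho> (\<rho> i) = \<rho> i"
    and prod_eq: "(\<Prod>i\<in>I. 1 - fps_const (z i) * fps_X ^ a i) =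
      (\<Prod>r\<in>\<rho> ` I. 1 - fps_X ^ (\<Sum>i\<in>{i\<in>I. \<rho> i = r}. a i))"
  shows "solution_sum z a I l =
    of_nat (card {m \<in> weighted_solutions a I l. \<forall>i\<in>I. m (\<rho> i) = m i})"
proof -
  let ?b = "\<lambda>r. \<Sum>i\<in>{i\<in>I. \<rho> i = r}. a i"
  let ?P = "\<Prod>i\<in>I. 1 - fps_const (z i) * fps_X ^ a i"
  let ?F = "Abs_fps (solution_sum z a I)"
  let ?G = "Abs_fps (solution_sum (\<lambda>_. 1) ?b (\<rho> ` I))"
  have "?b r > 0" if "r \<in> \<rho> ` I" for r
    using that assms(1,2) by (auto intro!: sum_pos)
  then have "(\<Prod>r\<in>\<rho> ` I. 1 - fps_const 1 * fps_X ^ ?b r) * ?G = 1"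
    using assms(1) by (intro solution_sum_fps) auto
  then have G: "?P * ?G = 1"
    by (simp add: prod_eq)
  have F: "?P * ?F = 1"
    using assms by (intro solution_sum_fps) auto
  \<comment> \<open>Both series are inverse to \<open>?P\<close>, and inverses are unique. With all
    \<open>z\<close> equal to 1, the coefficients of \<open>?G\<close> are plain
    cardinalities.\<close>
  have "?F = (?P * ?G) * ?F"
    by (simp add: G)
  also have "\<dots> = (?P * ?F) * ?G"
    by (simp only: ac_simps)
  finally have "?F = ?G"
    by (simp add: F)
  then have "fps_nth ?F l = fps_nth ?G l"
    by simp
  then show ?thesis
    using assms(1,3,4) by (simp add: card_folded_solutions) (simp add: solution_sum_def)
qed

section \<open>Affine types\<close>

lemma poly_map_poly_of_nat_add:
  "poly (map_poly of_nat (p + q)) x =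
    poly (map_poly of_nat p) x + poly (map_poly of_nat q) (x::'a::comm_semiring_1)"
proof -
  have "map_poly of_nat (p + q) = map_poly of_nat p + (map_poly of_nat q :: 'a poly)"
    by (simp add: poly_eq_iff coeff_map_poly)
  then show ?thesis
    by simp
qed

lemma poly_map_poly_of_nat_sum:
  "poly (map_poly of_nat (\<Sum>i\<in>I. p i)) x =
    (\<Sum>i\<in>I. poly (map_poly of_nat (p i)) (x::'a::comm_semiring_1))"
  by (induction I rule: infinite_finite_induct) (simp_all add: poly_map_poly_of_nat_add)

lemma dominant_weights_eq_weighted_solutions:
  "dominant_weights T l = weighted_solutions ((!) (comarks T)) {..rk T} l"
  by (simp add: dominant_weights_def weighted_solutions_def not_le)

text \<open>The monomial of \<open>m\<close> evaluates to the product of the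
  \<open>(w ^ s_i) ^ m i\<close>, so the sieving vector enters only through
  \<open>z i = w ^ s_i\<close>.\<close>

lemma poly_weight_poly:
  "poly (map_poly of_nat (weight_poly T l)) w =
    solution_sum (\<lambda>i. w ^ (sieving_vector T ! i)) ((!) (comarks T)) {..rk T} l"
  by (simp add: weight_poly_def solution_sum_def dominant_weights_eq_weighted_solutions
      poly_map_poly_of_nat_sum map_poly_monom poly_monom power_sum power_mult)

section \<open>The permutations and their orbits\<close>

text \<open>Induction on the number of transpositions: a new one moves only two points that all
  earlier ones fix. An even \<open>i\<close> equal to \<open>n\<close> has no partner and stays
  fixed.\<close>

lemma adjacent_pairs_apply:
  "adjacent_pairs n i =
    (if even i then if i < n then i + 1 else i else if i \<le> n then i - 1 else i)"
proof -
  \<comment> \<open>In the fold over an appended list the last factor becomes the initial value;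
    this separates it from the induction hypothesis.\<close>
  have foldr_comp: "foldr (\<circ>) fs g = foldr (\<circ>) fs id \<circ> g" for fs and g :: "nat \<Rightarrow> nat"
    by (induction fs) (simp_all add: comp_assoc)
  have "foldr (\<circ>) (map (\<lambda>k. transpose (2 * k) (2 * k + 1)) [0..<N]) id i =
    (if i < 2 * N then if even i then i + 1 else i - 1 else i)" for N i :: nat
  proof (induction N arbitrary: i)
    case (Suc N)
    have "foldr (\<circ>) (map (\<lambda>k. transpose (2 * k) (2 * k + 1)) [0..<Suc N]) id i =
        foldr (\<circ>) (map (\<lambda>k. transpose (2 * k) (2 * k + 1)) [0..<N]) id
          (transpose (2 * N) (2 * N + 1) i)"
      using foldr_comp[of _ "transpose (2 * N) (2 * N + 1)"] by simp
    also have "\<dots> = (if i < 2 * Suc N then if even i then i + 1 else i - 1 else i)"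
      unfolding Suc by (auto simp: transpose_def less_Suc_eq)
    finally show ?case .
  qed simp
  then show ?thesis
    unfolding adjacent_pairs_def by (auto elim!: evenE oddE)
qed

text \<open>On the vertices \<open>0\<close> to \<open>rk T\<close> this selects the least element
  of the orbit under \<open>upsilon\<close>.\<close>

fun orbit_rep :: "affine_type \<Rightarrow> nat \<Rightarrow> nat" where
  "orbit_rep (B1 n) i = (if i = n then 0 else i)"
| "orbit_rep (C1 n) i = (if odd i then i - 1 else i)"
| "orbit_rep (A2 n) i = (if odd i then i - 1 else i)"
| "orbit_rep (D2 n) i = (if i = n then 0 else i)"
| "orbit_rep E6 i = (if i \<in> {1, 6} then 0 else if i \<in> {3, 5} then 2 else i)"
| "orbit_rep E7 i = (if i = 7 then 0 else if i = 6 then 1 else if i = 5 then 3 else i)"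

lemma upsilon_E6:
  "upsilon E6 i = (if i = 0 then 1 else if i = 1 then 6 else if i = 6 then 0
    else if i = 2 then 3 else if i = 3 then 5 else if i = 5 then 2 else i)"
  by (simp add: transpose_def)

lemma upsilon_E7:
  "upsilon E7 i = (if i = 0 then 7 else if i = 7 then 0 else if i = 1 then 6 else if i = 6 then 1
    else if i = 3 then 5 else if i = 5 then 3 else i)"
  by (simp add: transpose_def)

lemma adjacent_pairs_involution: "adjacent_pairs n (adjacent_pairs n i) = i"
  unfolding adjacent_pairs_apply by (auto elim!: oddE)

lemma funpow_upsilon: "upsilon T ^^ N_of T = id"
proof (cases T)
  case E6
  have "upsilon E6 (upsilon E6 (upsilon E6 i)) = i" for i
  proof (cases "i \<in> {0, 1, 2, 3, 5, 6}")
    case False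
    then have "upsilon E6 i = i"
      by (simp add: upsilon_E6 del: upsilon.simps)
    then show ?thesis
      by (simp only:)
  qed (elim insertE emptyE; simp add: upsilon_E6 del: upsilon.simps)
  then show ?thesis
    by (simp add: E6 fun_eq_iff numeral_3_eq_3 del: upsilon.simps)
next
  case E7
  have "upsilon E7 (upsilon E7 i) = i" for i
  proof (cases "i \<in> {0, 1, 3, 5, 6, 7}")
    case False
    then have "upsilon E7 i = i"
      by (simp add: upsilon_E7 del: upsilon.simps)
    then show ?thesis
      by (simp only:)
  qed (elim insertE emptyE; simp add: upsilon_E7 del: upsilon.simps)
  then show ?thesis
    by (simp add: E7 fun_eq_iff numeral_2_eq_2 del: upsilon.simps)
qed (simp_all add: fun_eq_iff numeral_2_eq_2 adjacent_pairs_involution)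

lemma upsilon_le_rk: "i \<le> rk T \<Longrightarrow> upsilon T i \<le> rk T"
  by (cases T) (auto simp del: upsilon.simps(5,6)
      simp: upsilon_E6 upsilon_E7 adjacent_pairs_apply transpose_def)

lemma upsilon_gt_rk: "i > rk T \<Longrightarrow> upsilon T i = i"
  by (cases T) (auto simp del: upsilon.simps(5,6)
      simp: upsilon_E6 upsilon_E7 adjacent_pairs_apply transpose_def)

lemma upsilon_permutes: "upsilon T permutes {..rk T}"
proof -
  \<comment> \<open>Finite order makes the \<open>k\<close>-th power a two-sided inverse of
    \<open>upsilon T\<close>.\<close>
  obtain k where "N_of T = Suc k"
    by (cases T) auto
  then have "upsilon T \<circ> upsilon T ^^ k = id" "upsilon T ^^ k \<circ> upsilon T = id"
    using funpow_upsilon[of T] by (simp_all add: funpow_Suc_right[symmetric] del: funpow_Suc_right)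
  then have "bij (upsilon T)"
    by (rule o_bij[rotated])
  then show ?thesis
    using upsilon_gt_rk by (auto simp: permutes_def bij_iff)
qed

text \<open>In every type the permutation exchanges only vertices with equal coefficient; this is
  why the action preserves the level.\<close>

lemma comarks_upsilon:
  assumes "valid_type T" "i \<le> rk T"
  shows "comarks T ! upsilon T i = comarks T ! i"
  using assms
  by (cases T) (auto simp del: upsilon.simps(5,6)
      simp: upsilon_E6 upsilon_E7 adjacent_pairs_apply transpose_def nth_append nth_Cons'
        elim!: oddE)

lemma comarks_pos: "valid_type T \<Longrightarrow> i \<le> rk T \<Longrightarrow> comarks T ! i > 0"
  by (cases T) (auto simp: nth_append nth_Cons')

lemma orbit_rep_upsilon: "i \<le> rk T \<Longrightarrow> orbit_rep T (upsilon T i) = orbit_rep T i"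
proof (cases T)
  case E6
  then show ?thesis unfolding E6 upsilon_E6 by simp
next
  case E7
  then show ?thesis unfolding E7 upsilon_E7 by simp
qed (auto simp: adjacent_pairs_apply transpose_def)

text \<open>Orbits have at most three elements, so two steps reach the representative. Together with
  invariance under \<open>upsilon\<close>, this identifies the fibres of \<open>orbit_rep\<close>
  with the orbits.\<close>

lemma orbit_rep_in_orbit:
  "i \<le> rk T \<Longrightarrow> orbit_rep T i \<in> {i, upsilon T i, upsilon T (upsilon T i)}"
proof (cases T)
  case E6
  then show ?thesis unfolding E6 upsilon_E6 by simp
next
  case E7
  then show ?thesis unfolding E7 upsilon_E7 by simp
qed (auto simp: adjacent_pairs_apply transpose_def)

lemma orbit_rep_le: "i \<le> rk T \<Longrightarrow> orbit_rep T i \<le> rk T"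
  by (cases T) auto

lemma orbit_rep_idem: "orbit_rep T (orbit_rep T i) = orbit_rep T i"
  by (cases T) auto

section \<open>The action on weights\<close>

lemma sigma_fixed_iff:
  assumes "m \<in> dominant_weights T l"
  shows "sigma T m = m \<longleftrightarrow> (\<forall>i\<in>{..rk T}. m (orbit_rep T i) = m i)"
proof
  assume "sigma T m = m"
  then have "m (upsilon T i) = m i" for i
    by (simp add: sigma_def fun_eq_iff)
  then show "\<forall>i\<in>{..rk T}. m (orbit_rep T i) = m i"
    using orbit_rep_in_orbit by fastforce
next
  assume rep: "\<forall>i\<in>{..rk T}. m (orbit_rep T i) = m i"
  have "m (upsilon T i) = m i" for i
  proof (cases "i \<le> rk T")
    case True
    then show ?thesis
      using rep orbit_rep_upsilon[of i T] upsilon_le_rk[of i T] by (metis atMost_iff)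
  qed (simp add: upsilon_gt_rk)
  then show "sigma T m = m"
    by (simp add: sigma_def)
qed

lemma sigma_closed:
  assumes "valid_type T"
  shows "sigma T \<in> dominant_weights T l \<rightarrow> dominant_weights T l"
proof
  fix m assume m: "m \<in> dominant_weights T l"
  \<comment> \<open>Once the coefficient also carries the index \<open>upsilon T i\<close>, the
    level sum is merely reindexed by a permutation.\<close>
  have "(\<Sum>i\<le>rk T. comarks T ! i * m (upsilon T i)) =
      (\<Sum>i\<le>rk T. comarks T ! upsilon T i * m (upsilon T i))"
    using comarks_upsilon[OF assms] by simp
  also have "\<dots> = (\<Sum>i\<le>rk T. comarks T ! i * m i)"
    using sum.permute[OF upsilon_permutes, of "\<lambda>i. comarks T ! i * m i"]
    by (simp add: o_def)
  finally show "sigma T m \<in> dominant_weights T l"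
    using m by (simp add: dominant_weights_def sigma_def upsilon_gt_rk)
qed

lemma funpow_sigma: "(sigma T ^^ N_of T) m = m"
proof -
  have "(sigma T ^^ k) m = m \<circ> upsilon T ^^ k" for k
    by (induction k) (simp_all add: sigma_def fun_eq_iff funpow_swap1)
  then show ?thesis
    by (simp add: funpow_upsilon)
qed

section \<open>Orbit products at primitive roots of unity\<close>

lemma primitive_root_of_unity_2: "primitive_root_of_unity 2 w \<Longrightarrow> w = -1"
  by (auto simp: primitive_root_of_unity_def power2_eq_1_iff dest: spec[of _ 1])

lemma primitive_root_of_unity_3:
  assumes "primitive_root_of_unity 3 w"
  shows "w\<^sup>2 = - 1 - w"
proof -
  have "w \<noteq> 1" "w ^ 3 = 1"
    using assms by (auto simp: primitive_root_of_unity_def dest: spec[of _ 1])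
  moreover have "(w - 1) * (w\<^sup>2 + w + 1) = w ^ 3 - 1"
    by (simp add: algebra_simps power2_eq_square power3_eq_cube)
  ultimately have "w\<^sup>2 + w + 1 = 0"
    by auto
  then show ?thesis
    by (simp add: algebra_simps eq_neg_iff_add_eq_0)
qed

lemma fps_const_minus_one: "fps_const (- 1) = (- 1 :: 'a::comm_ring_1 fps)"
  by (simp flip: fps_const_neg)

lemma pair_product: "(1 - x ^ a) * (1 + x ^ a) = 1 - (x :: 'a::comm_ring_1) ^ (2 * a)"
  by (simp add: distrib_left left_diff_distrib mult_2 power_add)

lemma triple_product:
  fixes c x :: "'a::comm_ring_1"
  assumes "c\<^sup>2 = - 1 - c"
  shows "(1 - x ^ a) * ((1 - c * x ^ a) * (1 - c\<^sup>2 * x ^ a)) = 1 - x ^ (3 * a)"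
proof -
  \<comment> \<open>Here \<open>c\<^sup>2\<close> is replaced by \<open>- 1 - c\<close> in the last
    factor. The deviation from \<open>1 - y ^ 3\<close> is then a multiple of
    \<open>c\<^sup>2 + c + 1\<close>, which vanishes.\<close>
  have "(1 - y) * ((1 - c * y) * (1 - (- 1 - c) * y)) =
      1 - y ^ 3 + (c\<^sup>2 + 1 + c) * (y ^ 3 - y\<^sup>2)" for y
    by (simp add: algebra_simps power2_eq_square power3_eq_cube)
  from this[of "x ^ a"] show ?thesis
    by (simp add: assms power_mult[symmetric] mult.commute)
qed

text \<open>On an orbit of size \<open>N_of T\<close> the comarks agree and the sieving vector takes
  each value below \<open>N_of T\<close> once, so the factors multiply to
  \<open>1 - x ^ (N * a)\<close>. On a fixed vertex the sieving vector is 0 and the single factor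
  already has the right form.\<close>

lemma fibre_product:
  assumes "valid_type T" "T \<noteq> E7" "primitive_root_of_unity (N_of T) w"
    and r: "r \<in> orbit_rep T ` {..rk T}"
  defines "F \<equiv> {i \<in> {..rk T}. orbit_rep T i = r}"
  shows "(\<Prod>i\<in>F. 1 - fps_const (w ^ (sieving_vector T ! i)) * fps_X ^ (comarks T ! i)) =
    1 - fps_X ^ (\<Sum>i\<in>F. comarks T ! i)"
proof -
  let ?s = "\<lambda>i. sieving_vector T ! i" and ?a = "\<lambda>i. comarks T ! i"
  have single: ?thesis if "F = {r}" "?s r = 0"
    using that by simp
  have pair: ?thesis if "F = {i, j}" "i \<noteq> j" "?s i = 0" "?s j = 1" "?a i = ?a j" "N_of T = 2" for i j
  proof -
    have "w = -1"
      using assms(3) that(6) primitive_root_of_unity_2 by simp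
    then show ?thesis
      using that(1-5) pair_product[of fps_X "?a j"] by (simp add: mult_2 fps_const_minus_one)
  qed
  have triple: ?thesis if "F = {i, j, k}" "i \<noteq> j" "i \<noteq> k" "j \<noteq> k"
    "?s i = 0" "?s j = 1" "?s k = 2" "?a i = ?a k" "?a j = ?a k" "N_of T = 3" for i j k
  proof -
    have "w\<^sup>2 = - 1 - w"
      using assms(3) that(10) primitive_root_of_unity_3 by simp
    \<comment> \<open>The relation for \<open>w\<close> is lifted to constant power series, where
      \<open>triple_product\<close> is applied.\<close>
    then have "(fps_const w)\<^sup>2 = - 1 - fps_const w"
      by (simp only: fps_const_power fps_const_1_eq_1[symmetric] fps_const_neg fps_const_sub)
    from triple_product[OF this, of fps_X "?a k"] show ?thesis
      using that(1-9) by (simp add: numeral_3_eq_3)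
  qed
  \<comment> \<open>Orbit shapes for \<open>B1\<close> and \<open>D2\<close>; the next fact treats
    \<open>C1\<close> and \<open>A2\<close>, where a last even vertex \<open>n\<close> stands
    alone.\<close>
  have ends: "F = (if r = 0 then {0, n} else {r})" "r < n"
    if "rk T = n" "orbit_rep T = (\<lambda>i. if i = n then 0 else i)" "n > 0" for n
    using r that by (auto simp: F_def)
  have adjacent: "F = (if r < n then {r, r + 1} else {r})" "even r" "r \<le> n"
    if "rk T = n" "orbit_rep T = (\<lambda>i. if odd i then i - 1 else i)" for n
  proof -
    show "even r" "r \<le> n"
      using r that by auto
    then show "F = (if r < n then {r, r + 1} else {r})"
      using that by (auto simp: F_def elim!: oddE)
  qed
  show ?thesis
  proof (cases T)
    case (B1 n)
    then have F: "F = (if r = 0 then {0, n} else {r})" "r < n"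
      using ends[of n] assms(1) by (auto simp: fun_eq_iff)
    show ?thesis
    proof (cases "r = 0")
      case True
      show ?thesis
        by (rule pair[of 0 n])
          (use F True B1 assms(1) in \<open>auto simp: nth_append nth_Cons' numeral_2_eq_2\<close>)
    next
      case False
      show ?thesis
        by (rule single) (use F False B1 in \<open>simp_all add: nth_append\<close>)
    qed
  next
    case (D2 n)
    then have F: "F = (if r = 0 then {0, n} else {r})" "r < n"
      using ends[of n] assms(1) by (auto simp: fun_eq_iff)
    show ?thesis
    proof (cases "r = 0")
      case True
      show ?thesis
        by (rule pair[of 0 n])
          (use F True D2 assms(1) in \<open>auto simp: nth_append nth_Cons' numeral_2_eq_2\<close>)
    next
      case False
      show ?thesis
        by (rule single) (use F False D2 in \<open>simp_all add: nth_append\<close>)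
    qed
  next
    case (C1 n)
    then have F: "F = (if r < n then {r, r + 1} else {r})" "even r" "r \<le> n"
      using adjacent[of n] by (auto simp: fun_eq_iff)
    show ?thesis
    proof (cases "r < n")
      case True
      show ?thesis
        by (rule pair[of r "r + 1"])
          (use F True C1 in \<open>auto simp: nth_append nth_Cons' simp del: upt_Suc\<close>)
    next
      case False
      show ?thesis
        by (rule single) (use F False C1 in \<open>auto simp: nth_append simp del: upt_Suc\<close>)
    qed
  next
    case (A2 n)
    then have F: "F = (if r < n then {r, r + 1} else {r})" "even r" "r \<le> n"
      using adjacent[of n] by (auto simp: fun_eq_iff)
    show ?thesis
    proof (cases "r < n")
      case True
      show ?thesis
        by (rule pair[of r "r + 1"])
          (use F True A2 in \<open>auto simp: nth_append nth_Cons' simp del: upt_Suc\<close>)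
    next
      case False
      show ?thesis
        by (rule single) (use F False A2 in \<open>auto simp: nth_append simp del: upt_Suc\<close>)
    qed
  next
    case E6
    then have I: "{..rk T} = {0, 1, 2, 3, 4, 5, 6}"
      by auto
    from r consider "r = 0" | "r = 2" | "r = 4"
      unfolding I unfolding E6 by auto
    then show ?thesis
    proof cases
      case 1
      have "F = {0, 1, 6}"
        unfolding F_def I E6 1 by auto
      then show ?thesis
        by (rule triple) (simp_all add: E6)
    next
      case 2
      \<comment> \<open>Listed in this order, the vertices have sieving values 0, 1, 2, as
        \<open>triple\<close> expects.\<close>
      have "F = {2, 5, 3}"
        unfolding F_def I E6 2 by auto
      then show ?thesis
        by (rule triple) (simp_all add: E6)
    next
      case 3
      have "F = {r}"
        unfolding F_def I E6 3 by auto
      then show ?thesis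
        by (rule single) (simp add: E6 3)
    qed
  qed (use assms(2) in simp)
qed

text \<open>
  For \<open>E7\<close> the identity does not hold orbit by orbit: the sign carried by the fixed vertex \<open>2\<close>
  is needed for the orbit \<open>{1, 6}\<close>, on which the sieving vector vanishes.
\<close>

lemma E7_product:
  fixes w :: complex
  assumes "w = -1"
  shows "(\<Prod>i\<le>7. 1 - fps_const (w ^ (sieving_vector E7 ! i)) * fps_X ^ (comarks E7 ! i)) =
    (\<Prod>r\<in>orbit_rep E7 ` {..7}. 1 - fps_X ^ (\<Sum>i\<in>{i\<in>{..7}. orbit_rep E7 i = r}. comarks E7 ! i))"
proof -
  have I: "{..7} = {0, 1, 2, 3, 4, 5, 6, 7::nat}"
    by auto
  have R: "orbit_rep E7 ` {..7} = {0, 1, 2, 3, 4}"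
    unfolding I by auto
  have F: "{i\<in>{..7}. orbit_rep E7 i = 0} = {0, 7}" "{i\<in>{..7}. orbit_rep E7 i = 1} = {1, 6}"
    "{i\<in>{..7}. orbit_rep E7 i = 2} = {2}" "{i\<in>{..7}. orbit_rep E7 i = 3} = {3, 5}"
    "{i\<in>{..7}. orbit_rep E7 i = 4} = {4}"
    unfolding I by auto
  have P: "(\<Prod>r\<in>{0, 1, 2, 3, 4}. g r) = g 0 * g 1 * g 2 * g 3 * g 4" for g :: "nat \<Rightarrow> complex fps"
    by (simp add: mult.assoc)
  \<comment> \<open>Vertices 1 and 6 each give \<open>1 - fps_X ^ 2\<close>, and vertex 2 gives
    \<open>1 + fps_X ^ 2\<close>. One of the former combines with the latter into the factor of the
    orbit \<open>{1, 6}\<close>; the other becomes the factor of the orbit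
    \<open>{2}\<close>.\<close>
  have "(\<Prod>i\<le>7. 1 - fps_const (w ^ (sieving_vector E7 ! i)) * fps_X ^ (comarks E7 ! i)) =
      ((1 - fps_X ^ 1) * (1 + fps_X ^ 1)) * ((1 - fps_X ^ 2) * (1 + fps_X ^ 2)) * (1 - fps_X ^ 2) *
      ((1 - fps_X ^ 3) * (1 + fps_X ^ 3)) * (1 - fps_X ^ 4 :: complex fps)"
    unfolding I assms by (simp add: ac_simps fps_const_minus_one)
  also have "\<dots> = (\<Prod>r\<in>orbit_rep E7 ` {..7}.
      1 - fps_X ^ (\<Sum>i\<in>{i\<in>{..7}. orbit_rep E7 i = r}. comarks E7 ! i))"
    unfolding R P F pair_product by (simp add: ac_simps numeral_eq_Suc)
  finally show ?thesis .
qed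

lemma orbit_product:
  assumes "valid_type T" "primitive_root_of_unity (N_of T) w"
  shows "(\<Prod>i\<in>{..rk T}. 1 - fps_const (w ^ (sieving_vector T ! i)) * fps_X ^ (comarks T ! i)) =
    (\<Prod>r\<in>orbit_rep T ` {..rk T}.
      1 - fps_X ^ (\<Sum>i\<in>{i\<in>{..rk T}. orbit_rep T i = r}. comarks T ! i))"
proof (cases "T = E7")
  case True
  then have "w = -1"
    using assms(2) primitive_root_of_unity_2 by simp
  from E7_product[OF this] True show ?thesis
    by (simp only: rk.simps)
next
  case False
  let ?f = "\<lambda>i. 1 - fps_const (w ^ (sieving_vector T ! i)) * fps_X ^ (comarks T ! i)"
  have "(\<Prod>i\<in>{..rk T}. ?f i) =
      (\<Prod>r\<in>orbit_rep T ` {..rk T}. \<Prod>i\<in>{i\<in>{..rk T}. orbit_rep T i = r}. ?f i)"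
    by (rule prod.group[symmetric]) auto
  also have "\<dots> = (\<Prod>r\<in>orbit_rep T ` {..rk T}.
      1 - fps_X ^ (\<Sum>i\<in>{i\<in>{..rk T}. orbit_rep T i = r}. comarks T ! i))"
    using fibre_product[OF assms(1) False assms(2)] by (intro prod.cong refl)
  finally show ?thesis .
qed

theorem theorem4p8:
  fixes T :: affine_type and l :: nat
  assumes "valid_type T"
  shows "cyclic_sieving (dominant_weights T l) (integer_mod_group (N_of T))
           (sigma_action T l) (weight_poly T l)"
proof -
  let ?X = "dominant_weights T l"
  have prime: "prime (N_of T)"
    by (cases T) simp_all
  have fin: "finite ?X"
    unfolding dominant_weights_eq_weighted_solutions
    using comarks_pos[OF assms] by (intro finite_weighted_solutions) auto
  have one: "poly (map_poly of_nat (weight_poly T l)) (1::complex) = of_nat (card ?X)"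
    unfolding poly_weight_poly
    by (simp add: solution_sum_def dominant_weights_eq_weighted_solutions)
  have root: "poly (map_poly of_nat (weight_poly T l)) w = of_nat (card {m \<in> ?X. sigma T m = m})"
    if w: "primitive_root_of_unity (N_of T) w" for w
  proof -
    \<comment> \<open>The folding result is applied with \<open>orbit_rep T\<close> as retraction;
      \<open>orbit_product\<close> supplies the equality of the two denominators.\<close>
    have "poly (map_poly of_nat (weight_poly T l)) w =
        of_nat (card {m \<in> ?X. \<forall>i\<in>{..rk T}. m (orbit_rep T i) = m i})"
      unfolding poly_weight_poly unfolding dominant_weights_eq_weighted_solutions
      using orbit_product[OF assms w] comarks_pos[OF assms] orbit_rep_le orbit_rep_idem
      by (intro solution_sum_eq_card_folded) auto
    also have "{m \<in> ?X. \<forall>i\<in>{..rk T}. m (orbit_rep T i) = m i} = {m \<in> ?X. sigma T m = m}"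
      using sigma_fixed_iff by blast
    finally show ?thesis .
  qed
  have "sigma_action T l = (\<lambda>k. restrict (sigma T ^^ nat k) ?X)"
    by (simp add: sigma_action_def fun_eq_iff)
  then show ?thesis
    using cyclic_sieving_prime_order[OF prime fin sigma_closed[OF assms] funpow_sigma one root]
    by simp
qed

end
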